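(* Let $(X,f_{1,\infty})$ be an NDS, let $m\in\mathbb{N}$ and let $A\subset\mathbb{N}$ be infinite. Then the following statements are equivalent: (1) for all non-empty open sets $U_0,U_1,\dots,U_m\subset X$ there exists an $n\in A$ such that $\bigcap_{i=0}^m f_1^{-in}(U_i)\neq\emptyset$; (2) there exists a dense $G_\delta$ subset $Y\subset X$ such that for every $x\in Y$, the set $\{(f_1^{n}(x),f_1^{2n}(x),\dots,f_1^{mn}(x)) : n\in A\}$ is dense in $X^m$. Moreover, if $A=\mathbb{N}$ and $f_{1,\infty}$ is commutative and surjective, then (1) and (2) are equivalent to the following: (3) there exists an $x\in X$ such that $\{(f_1^{n}(x),f_1^{2n}(x),\dots,f_1^{mn}(x)) : n\in\mathbb{N}\}$ is dense in $X^m$.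
   Context: $\mathbb{N}=\{1,2,3,\dots\}$. A non-autonomous discrete dynamical system (NDS) $(X,f_{1,\infty})$ consists of a compact metric space $(X,d)$ and a sequence $f_{1,\infty}=\{f_n\}_{n=1}^\infty$ of continuous maps $f_n:X\to X$. For $i,n\in\mathbb{N}$, $f_i^n:=f_{i+(n-1)}\circ\cdots\circ f_i$, and $f_i^0=\mathrm{id}_X$. For $N\ge 0$, $f_1^{-N}(U):=(f_1^N)^{-1}(U)$ denotes the preimage. $f_{1,\infty}$ is commutative if $f_i\circ f_j=f_j\circ f_i$ for all $i,j\in\mathbb{N}$; it is surjective if every $f_n$ is surjective. *)

theory Defs
  imports "HOL-Analysis.Analysis"
begin

text \<open>
  A sequence of maps indexed by the positive integers is rendered as a function on \<^typ>\<open>nat\<close>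
  whose value at \<open>0\<close> is irrelevant: nothing below refers to \<open>f 0\<close>.
  The phase space is the whole (hence non-empty) type \<^typ>\<open>'a\<close>.
\<close>

definition nds :: "(nat \<Rightarrow> 'a::metric_space \<Rightarrow> 'a) \<Rightarrow> bool" where
  "nds f \<longleftrightarrow> compact (UNIV :: 'a set) \<and> (\<forall>n\<ge>1. continuous_on UNIV (f n))"

text \<open>\<open>nds_iter f i n\<close> is the composition of the \<open>n\<close> maps \<open>f i, \<dots>, f (i + n - 1)\<close>, with \<open>f i\<close> applied first.\<close>

primrec nds_iter :: "(nat \<Rightarrow> 'a \<Rightarrow> 'a) \<Rightarrow> nat \<Rightarrow> nat \<Rightarrow> 'a \<Rightarrow> 'a" where
  "nds_iter f i 0 = id"
| "nds_iter f i (Suc n) = f (i + n) \<circ> nds_iter f i n"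

definition nds_commutative :: "(nat \<Rightarrow> 'a \<Rightarrow> 'a) \<Rightarrow> bool" where
  "nds_commutative f \<longleftrightarrow> (\<forall>i\<ge>1. \<forall>j\<ge>1. f i \<circ> f j = f j \<circ> f i)"

definition nds_surjective :: "(nat \<Rightarrow> 'a \<Rightarrow> 'a) \<Rightarrow> bool" where
  "nds_surjective f \<longleftrightarrow> (\<forall>n\<ge>1. surj (f n))"

definition multi_transitive_along ::
    "(nat \<Rightarrow> 'a::topological_space \<Rightarrow> 'a) \<Rightarrow> nat \<Rightarrow> nat set \<Rightarrow> bool" where
  "multi_transitive_along f m A \<longleftrightarrow>
    (\<forall>U :: nat \<Rightarrow> 'a set. (\<forall>i\<in>{0..m}. open (U i) \<and> U i \<noteq> {}) \<longrightarrow>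
      (\<exists>n\<in>A. (\<Inter>i\<in>{0..m}. nds_iter f 1 (i * n) -` U i) \<noteq> {}))"

text \<open>Points of the \<open>m\<close>-fold power of \<^typ>\<open>'a\<close> are extensional functions on \<open>{1..m}\<close>.\<close>

definition power_topology :: "nat \<Rightarrow> (nat \<Rightarrow> 'a::topological_space) topology" where
  "power_topology m = product_topology (\<lambda>_. euclidean) {1..m}"

definition multi_orbit :: "(nat \<Rightarrow> 'a \<Rightarrow> 'a) \<Rightarrow> nat \<Rightarrow> nat set \<Rightarrow> 'a \<Rightarrow> (nat \<Rightarrow> 'a) set" where
  "multi_orbit f m A x = {(\<lambda>i\<in>{1..m}. nds_iter f 1 (i * n) x) | n. n \<in> A}"

definition dense_multi_orbit ::
    "(nat \<Rightarrow> 'a::topological_space \<Rightarrow> 'a) \<Rightarrow> nat \<Rightarrow> nat set \<Rightarrow> 'a \<Rightarrow> bool" where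
  "dense_multi_orbit f m A x \<longleftrightarrow>
    power_topology m closure_of multi_orbit f m A x = topspace (power_topology m)"

end

theory Submission
  imports Defs
begin

text \<open>
  (1) to (2): for each tuple \<open>(V\<^sub>1, \<dots>, V\<^sub>m)\<close> of members of a countable base, the points \<open>x\<close> with
  \<open>f\<^sub>1\<^sup>i\<^sup>n x \<in> V\<^sub>i\<close> for all \<open>i\<close> and some \<open>n \<in> A\<close> form an open set, and (1) with an arbitrary
  \<open>U\<^sub>0\<close> says that this set is dense; Baire's theorem applies to the intersection over all tuples.
  (3) to (1): choose \<open>k\<close> with \<open>f\<^sub>1\<^sup>k x \<in> U\<^sub>0\<close> and apply density of the orbit of \<open>x\<close> to the sets
  \<open>f\<^sub>1\<^sup>-\<^sup>k(U\<^sub>i)\<close>, which are non-empty by surjectivity; by commutativity \<open>f\<^sub>1\<^sup>k x\<close> is a common point.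
\<close>

section \<open>Countable bases and Baire category in a compact metric space\<close>

text \<open>Compactness gives total boundedness, so for each n finitely many balls of radius 1/(n+1)
  cover the space; collecting them over all n yields the base.\<close>

lemma compact_UNIV_countable_basis:
  assumes "compact (UNIV :: 'a::metric_space set)"
  obtains \<B> :: "'a::metric_space set set" where "countable \<B>" "\<And>V. V \<in> \<B> \<Longrightarrow> open V \<and> V \<noteq> {}"
    "\<And>U x. open U \<Longrightarrow> x \<in> U \<Longrightarrow> \<exists>V\<in>\<B>. x \<in> V \<and> V \<subseteq> U"
proof -
  have "\<forall>\<epsilon>>0. \<exists>k. finite k \<and> (UNIV :: 'a set) \<subseteq> (\<Union>x\<in>k. ball x \<epsilon>)"
    using assms by (simp add: compact_eq_totally_bounded)
  then have "\<exists>k. finite k \<and> (UNIV :: 'a set) \<subseteq> (\<Union>x\<in>k. ball x (1 / real (Suc n)))" for n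
    by simp
  then obtain K where K: "\<And>n. finite (K n)"
      "\<And>n. (UNIV :: 'a set) \<subseteq> (\<Union>x\<in>K n. ball x (1 / real (Suc n)))"
    by metis
  define \<B> where "\<B> = (\<Union>n. (\<lambda>x. ball x (1 / real (Suc n))) ` K n)"
  show thesis
  proof
    show "countable \<B>"
      unfolding \<B>_def using K(1) by (intro countable_UN) (auto intro: countable_finite)
    show "open V \<and> V \<noteq> {}" if "V \<in> \<B>" for V
      using that by (auto simp: \<B>_def)
    show "\<exists>V\<in>\<B>. x \<in> V \<and> V \<subseteq> U" if U: "open U" "x \<in> U" for U x
    proof -
      obtain e where e: "e > 0" "ball x e \<subseteq> U"
        using U openE by blast
      \<comment> \<open>Half of \<open>e\<close>, because a point z of the small ball around y is
        reached from x through y, at the cost of two radii.\<close>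
      obtain n where n: "1 / real (Suc n) < e / 2"
        using nat_approx_posE[of "e / 2"] e(1) by auto
      obtain y where y: "y \<in> K n" "x \<in> ball y (1 / real (Suc n))"
        using K(2)[of n] by blast
      have "ball y (1 / real (Suc n)) \<subseteq> ball x e"
      proof
        fix z assume "z \<in> ball y (1 / real (Suc n))"
        then show "z \<in> ball x e"
          using y(2) n dist_triangle[of x z y] by (simp add: dist_commute)
      qed
      with y e show ?thesis
        unfolding \<B>_def by blast
    qed
  qed
qed

lemma gdelta_countable_Inter:
  assumes "countable \<G>" "\<And>G. G \<in> \<G> \<Longrightarrow> open G"
  shows "gdelta (\<Inter>\<G>)"
proof (cases "\<G> = {}")
  \<comment> \<open>\<open>gdelta\<close> is introduced from a sequence of open sets, and an empty
    family cannot be enumerated; its intersection is the whole space.\<close>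
  case True
  then show ?thesis
    using gdelta.intros[of "\<lambda>_. UNIV"] by simp
next
  case False
  then have "range (from_nat_into \<G>) = \<G>"
    using assms(1) by (rule range_from_nat_into)
  then show ?thesis
    using gdelta.intros[of "from_nat_into \<G>"] assms(2) by (metis rangeI)
qed

text \<open>This is Baire's theorem for locally compact regular spaces: compactness gives the first
  property, the metric the second.\<close>

lemma compact_UNIV_Baire:
  assumes "compact (UNIV :: 'a::metric_space set)"
    and "countable \<G>" "\<And>G. G \<in> \<G> \<Longrightarrow> open G \<and> closure G = (UNIV :: 'a::metric_space set)"
  shows "closure (\<Inter>\<G>) = UNIV"
proof -
  have "locally_compact_space (euclidean :: 'a topology)"
    using assms(1) by (intro compact_imp_locally_compact_space) (simp add: compact_space_def)
  then have "euclidean closure_of (\<Inter>\<G>) = topspace (euclidean :: 'a topology)"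
    using assms(2,3) by (intro Baire_category) (auto simp: regular_space_euclidean)
  then show ?thesis
    by simp
qed

section \<open>Density and transitivity tested on open boxes\<close>

text \<open>Open boxes form a base of the finite product, so density need only be tested on them.
  Later arguments can then avoid extensional functions and the product topology.\<close>

lemma dense_multi_orbit_iff:
  fixes f :: "nat \<Rightarrow> 'a::topological_space \<Rightarrow> 'a"
  shows "dense_multi_orbit f m A x \<longleftrightarrow>
    (\<forall>U. (\<forall>i\<in>{1..m}. open (U i) \<and> U i \<noteq> {}) \<longrightarrow>
      (\<exists>n\<in>A. \<forall>i\<in>{1..m}. nds_iter f 1 (i * n) x \<in> U i))"
  (is "_ \<longleftrightarrow> ?R")
proof
  assume dense: "dense_multi_orbit f m A x"
  show ?R
  proof (intro allI impI)
    fix U :: "nat \<Rightarrow> 'a set" assume U: "\<forall>i\<in>{1..m}. open (U i) \<and> U i \<noteq> {}"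
    then have "openin (power_topology m) (PiE {1..m} U)" "PiE {1..m} U \<noteq> {}"
      unfolding power_topology_def by (auto simp: openin_PiE PiE_eq_empty_iff)
    with dense have "multi_orbit f m A x \<inter> PiE {1..m} U \<noteq> {}"
      unfolding dense_multi_orbit_def dense_intersects_open by blast
    then show "\<exists>n\<in>A. \<forall>i\<in>{1..m}. nds_iter f 1 (i * n) x \<in> U i"
      unfolding multi_orbit_def by (fastforce simp: PiE_iff)
  qed
next
  assume R: ?R
  show "dense_multi_orbit f m A x"
    unfolding dense_multi_orbit_def dense_intersects_open
  proof (intro allI impI)
    fix T :: "(nat \<Rightarrow> 'a) set" assume T: "openin (power_topology m) T \<and> T \<noteq> {}"
    then obtain t where "t \<in> T"
      by blast
    with T obtain U where U: "\<forall>i\<in>{1..m}. open (U i)" "t \<in> PiE {1..m} U" "PiE {1..m} U \<subseteq> T"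
      unfolding power_topology_def openin_product_topology_alt by (metis open_openin)
    \<comment> \<open>Each side \<open>U i\<close> contains the coordinate
      \<open>t i\<close>.\<close>
    then have "\<forall>i\<in>{1..m}. open (U i) \<and> U i \<noteq> {}"
      by (metis PiE_mem empty_iff)
    with R obtain n where "n \<in> A" "\<forall>i\<in>{1..m}. nds_iter f 1 (i * n) x \<in> U i"
      by blast
    then have "(\<lambda>i\<in>{1..m}. nds_iter f 1 (i * n) x) \<in> multi_orbit f m A x \<inter> PiE {1..m} U"
      unfolding multi_orbit_def by auto
    with U(3) show "multi_orbit f m A x \<inter> T \<noteq> {}"
      by blast
  qed
qed

text \<open>The index 0 contributes the preimage under \<open>nds_iter f 1 0 = id\<close>, so its
  open set just says where the point x itself lies. Split off as \<open>W\<close>, it leaves the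
  same box condition as in \<open>dense_multi_orbit_iff\<close>.\<close>

lemma multi_transitive_along_iff:
  fixes f :: "nat \<Rightarrow> 'a::topological_space \<Rightarrow> 'a"
  shows "multi_transitive_along f m A \<longleftrightarrow>
    (\<forall>W U. open W \<and> W \<noteq> {} \<and> (\<forall>i\<in>{1..m}. open (U i) \<and> U i \<noteq> {}) \<longrightarrow>
      (\<exists>n\<in>A. \<exists>x\<in>W. \<forall>i\<in>{1..m}. nds_iter f 1 (i * n) x \<in> U i))"
  (is "_ \<longleftrightarrow> ?R")
proof
  assume trans: "multi_transitive_along f m A"
  show ?R
  proof (intro allI impI)
    fix W :: "'a set" and U :: "nat \<Rightarrow> 'a set"
    assume WU: "open W \<and> W \<noteq> {} \<and> (\<forall>i\<in>{1..m}. open (U i) \<and> U i \<noteq> {})"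
    define V where "V = U(0 := W)"
    have "\<forall>i\<in>{0..m}. open (V i) \<and> V i \<noteq> {}"
      using WU by (auto simp: V_def)
    with trans obtain n where n: "n \<in> A" "(\<Inter>i\<in>{0..m}. nds_iter f 1 (i * n) -` V i) \<noteq> {}"
      unfolding multi_transitive_along_def by blast
    then obtain x where x: "\<forall>i\<in>{0..m}. nds_iter f 1 (i * n) x \<in> V i"
      by blast
    have "x \<in> W"
      using x[rule_format, of 0] by (simp add: V_def)
    moreover have "\<forall>i\<in>{1..m}. nds_iter f 1 (i * n) x \<in> U i"
    proof
      fix i assume "i \<in> {1..m}"
      then show "nds_iter f 1 (i * n) x \<in> U i"
        using x[rule_format, of i] by (simp add: V_def)
    qed
    ultimately show "\<exists>n\<in>A. \<exists>x\<in>W. \<forall>i\<in>{1..m}. nds_iter f 1 (i * n) x \<in> U i"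
      using n(1) by blast
  qed
next
  assume R: ?R
  show "multi_transitive_along f m A"
    unfolding multi_transitive_along_def
  proof (intro allI impI)
    fix U :: "nat \<Rightarrow> 'a set"
    assume U: "\<forall>i\<in>{0..m}. open (U i) \<and> U i \<noteq> {}"
    then have "open (U 0) \<and> U 0 \<noteq> {} \<and> (\<forall>i\<in>{1..m}. open (U i) \<and> U i \<noteq> {})"
      by auto
    with R have "\<exists>n\<in>A. \<exists>x\<in>U 0. \<forall>i\<in>{1..m}. nds_iter f 1 (i * n) x \<in> U i"
      by blast
    then obtain n x where n: "n \<in> A" "x \<in> U 0"
      and x: "\<forall>i\<in>{1..m}. nds_iter f 1 (i * n) x \<in> U i"
      by blast
    have "nds_iter f 1 (i * n) x \<in> U i" if "i \<in> {0..m}" for i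
      using that n(2) x by (cases "i = 0") auto
    with n(1) show "\<exists>n\<in>A. (\<Inter>i\<in>{0..m}. nds_iter f 1 (i * n) -` U i) \<noteq> {}"
      by blast
  qed
qed

section \<open>Continuity, surjectivity and commutation of the iterates\<close>

lemma continuous_on_nds_iter:
  assumes "\<forall>n\<ge>1. continuous_on UNIV (f n)" "i \<ge> 1"
  shows "continuous_on UNIV (nds_iter f i n)"
proof (induction n)
  case (Suc n)
  have "continuous_on UNIV (f (i + n))"
    using assms by simp
  with Suc show ?case
    unfolding nds_iter.simps by (meson continuous_on_compose continuous_on_subset subset_UNIV)
qed (simp add: id_def)

lemma surj_nds_iter:
  assumes "nds_surjective f" "i \<ge> 1"
  shows "surj (nds_iter f i n)"
proof (induction n)
  case (Suc n)
  have "surj (f (i + n))"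
    using assms by (simp add: nds_surjective_def)
  with Suc show ?case
    unfolding nds_iter.simps by (rule comp_surj)
qed simp

text \<open>Two inductions: a single map passes through an iterate factor by factor, and then a
  whole iterate does so map by map.\<close>

lemma nds_iter_commute:
  assumes "nds_commutative f" "i \<ge> 1" "j \<ge> 1"
  shows "nds_iter f i k (nds_iter f j n x) = nds_iter f j n (nds_iter f i k x)"
proof -
  have f_f: "f a (f b y) = f b (f a y)" if "a \<ge> 1" "b \<ge> 1" for a b y
    using assms(1) that unfolding nds_commutative_def by (metis comp_apply)
  have f_iter: "f a (nds_iter f j n y) = nds_iter f j n (f a y)" if "a \<ge> 1" for a y
    using assms(3) by (induction n) (simp_all add: f_f[OF that])
  show ?thesis
    using assms(2) by (induction k) (simp_all add: f_iter)
qed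

section \<open>The implications between (1), (2) and (3)\<close>

lemma multi_transitive_imp_dense_gdelta:
  fixes f :: "nat \<Rightarrow> 'a::metric_space \<Rightarrow> 'a"
  assumes "nds f" "multi_transitive_along f m A"
  shows "\<exists>Y. gdelta Y \<and> closure Y = UNIV \<and> (\<forall>x\<in>Y. dense_multi_orbit f m A x)"
proof -
  have cpt: "compact (UNIV :: 'a set)" and cont: "\<forall>n\<ge>1. continuous_on UNIV (f n)"
    using assms(1) by (auto simp: nds_def)
  obtain \<B> :: "'a set set" where \<B>: "countable \<B>" "\<And>V. V \<in> \<B> \<Longrightarrow> open V \<and> V \<noteq> {}"
    "\<And>U x. open U \<Longrightarrow> x \<in> U \<Longrightarrow> \<exists>V\<in>\<B>. x \<in> V \<and> V \<subseteq> U"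
    using compact_UNIV_countable_basis[OF cpt] by metis
  \<comment> \<open>\<open>G V\<close> consists of the points whose multi-orbit along
    \<open>A\<close> meets the box with sides \<open>V i\<close>. Indexing by extensional tuples
    over the finite set \<open>{1..m}\<close> keeps the family countable.\<close>
  define G where "G V = (\<Union>n\<in>A. \<Inter>i\<in>{1..m}. nds_iter f 1 (i * n) -` V i)" for V
  define \<G> where "\<G> = G ` (PiE {1..m} (\<lambda>_. \<B>))"
  have count: "countable \<G>"
    unfolding \<G>_def using \<B>(1) by (intro countable_image countable_PiE) auto
  have open_dense: "open S \<and> closure S = UNIV" if "S \<in> \<G>" for S
  proof -
    obtain V where S: "S = G V" and V: "\<forall>i\<in>{1..m}. open (V i) \<and> V i \<noteq> {}"
      using \<open>S \<in> \<G>\<close> \<B>(2) unfolding \<G>_def by (auto simp: PiE_iff)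
    have "open S"
      unfolding S G_def
      using V continuous_on_nds_iter[OF cont] by (intro open_UN open_INT ballI open_vimage) auto
    moreover have "W \<inter> S \<noteq> {}" if "open W" "W \<noteq> {}" for W
    proof -
      have "\<exists>n\<in>A. \<exists>x\<in>W. \<forall>i\<in>{1..m}. nds_iter f 1 (i * n) x \<in> V i"
        using assms(2)[unfolded multi_transitive_along_iff, rule_format, of W V] V that by blast
      then show ?thesis
        unfolding S G_def by blast
    qed
    then have "closure S = UNIV"
      using dense_intersects_open[of euclidean S] by (simp add: Int_commute)
    ultimately show ?thesis ..
  qed
  have "dense_multi_orbit f m A x" if x: "x \<in> \<Inter>\<G>" for x
    unfolding dense_multi_orbit_iff
  proof (intro allI impI)
    fix U :: "nat \<Rightarrow> 'a set" assume "\<forall>i\<in>{1..m}. open (U i) \<and> U i \<noteq> {}"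
    \<comment> \<open>Every non-empty open box contains a box with sides in the base, and hitting
      the smaller one suffices.\<close>
    then have "\<forall>i\<in>{1..m}. \<exists>V\<in>\<B>. V \<subseteq> U i"
      using \<B>(3) by (metis ex_in_conv)
    then obtain V where V: "\<forall>i\<in>{1..m}. V i \<in> \<B> \<and> V i \<subseteq> U i"
      by metis
    then have "restrict V {1..m} \<in> PiE {1..m} (\<lambda>_. \<B>)"
      by simp
    then have "x \<in> G (restrict V {1..m})"
      using x unfolding \<G>_def by blast
    with V show "\<exists>n\<in>A. \<forall>i\<in>{1..m}. nds_iter f 1 (i * n) x \<in> U i"
      unfolding G_def by fastforce
  qed
  then show ?thesis
    using gdelta_countable_Inter[OF count] compact_UNIV_Baire[OF cpt count open_dense] open_dense
    by blast
qed

lemma dense_imp_multi_transitive: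
  fixes f :: "nat \<Rightarrow> 'a::topological_space \<Rightarrow> 'a"
  assumes "closure Y = UNIV" "\<forall>x\<in>Y. dense_multi_orbit f m A x"
  shows "multi_transitive_along f m A"
  unfolding multi_transitive_along_iff
proof (intro allI impI)
  fix W :: "'a set" and U :: "nat \<Rightarrow> 'a set"
  assume WU: "open W \<and> W \<noteq> {} \<and> (\<forall>i\<in>{1..m}. open (U i) \<and> U i \<noteq> {})"
  then obtain x where "x \<in> W" "x \<in> Y"
    using open_Int_closure_eq_empty[of W Y] assms(1) by auto
  with assms(2) WU show "\<exists>n\<in>A. \<exists>x\<in>W. \<forall>i\<in>{1..m}. nds_iter f 1 (i * n) x \<in> U i"
    unfolding dense_multi_orbit_iff by blast
qed

lemma dense_multi_orbit_imp_multi_transitive: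
  fixes f :: "nat \<Rightarrow> 'a::metric_space \<Rightarrow> 'a"
  assumes "nds f" "nds_commutative f" "nds_surjective f" "m \<ge> 1" "dense_multi_orbit f m A x"
  shows "multi_transitive_along f m A"
  unfolding multi_transitive_along_iff
proof (intro allI impI)
  fix W :: "'a set" and U :: "nat \<Rightarrow> 'a set"
  assume WU: "open W \<and> W \<noteq> {} \<and> (\<forall>i\<in>{1..m}. open (U i) \<and> U i \<noteq> {})"
  \<comment> \<open>A time \<open>k\<close> with \<open>nds_iter f 1 k x\<close> in \<open>W\<close>
    comes from the box all of whose sides are \<open>W\<close>: its coordinate 1, available as
    \<open>m \<ge> 1\<close>, is the wanted one.\<close>
  have "\<exists>n\<in>A. \<forall>i\<in>{1..m}. nds_iter f 1 (i * n) x \<in> W"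
    using assms(5)[unfolded dense_multi_orbit_iff, rule_format, of "\<lambda>_. W"] WU by simp
  then obtain k where "\<forall>i\<in>{1..m}. nds_iter f 1 (i * k) x \<in> W"
    by blast
  then have k: "nds_iter f 1 k x \<in> W"
    using assms(4) by (metis atLeastAtMost_iff mult_1 order_refl)
  let ?V = "\<lambda>i. nds_iter f 1 k -` U i"
  have "open (?V i) \<and> ?V i \<noteq> {}" if "i \<in> {1..m}" for i
  proof
    show "open (?V i)"
      using WU that assms(1) by (intro open_vimage continuous_on_nds_iter) (auto simp: nds_def)
    show "?V i \<noteq> {}"
      using WU that surj_nds_iter[OF assms(3), of 1 k] by (simp add: surj_vimage_empty)
  qed
  then have "\<exists>n\<in>A. \<forall>i\<in>{1..m}. nds_iter f 1 (i * n) x \<in> ?V i"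
    using assms(5)[unfolded dense_multi_orbit_iff, rule_format, of ?V] by blast
  then obtain n where n: "n \<in> A" "\<forall>i\<in>{1..m}. nds_iter f 1 (i * n) x \<in> ?V i"
    by blast
  \<comment> \<open>Membership in \<open>?V i\<close> has \<open>nds_iter f 1 k\<close> applied
    last; commutation moves it to the inside, where it shifts the starting point into
    \<open>W\<close>.\<close>
  then have "\<forall>i\<in>{1..m}. nds_iter f 1 (i * n) (nds_iter f 1 k x) \<in> U i"
    using nds_iter_commute[OF assms(2), of 1 1 k] by simp
  with n(1) k show "\<exists>n\<in>A. \<exists>x\<in>W. \<forall>i\<in>{1..m}. nds_iter f 1 (i * n) x \<in> U i"
    by blast
qed

theorem theorem4:
  fixes f :: "nat \<Rightarrow> 'a::metric_space \<Rightarrow> 'a" and m :: nat and A :: "nat set"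
  assumes "nds f" and "m \<ge> 1" and "A \<subseteq> {1..}" and "infinite A"
  shows "(multi_transitive_along f m A \<longleftrightarrow>
            (\<exists>Y. gdelta Y \<and> closure Y = UNIV \<and> (\<forall>x\<in>Y. dense_multi_orbit f m A x)))
       \<and> (A = {1..} \<and> nds_commutative f \<and> nds_surjective f \<longrightarrow>
            (multi_transitive_along f m A \<longleftrightarrow> (\<exists>x. dense_multi_orbit f m {1..} x)) \<and>
            ((\<exists>Y. gdelta Y \<and> closure Y = UNIV \<and> (\<forall>x\<in>Y. dense_multi_orbit f m A x))
              \<longleftrightarrow> (\<exists>x. dense_multi_orbit f m {1..} x)))"
proof -
  let ?P2 = "\<exists>Y. gdelta Y \<and> closure Y = UNIV \<and> (\<forall>x\<in>Y. dense_multi_orbit f m A x)"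
  have 12: "multi_transitive_along f m A \<longleftrightarrow> ?P2"
    using multi_transitive_imp_dense_gdelta[OF assms(1)] dense_imp_multi_transitive by blast
  \<comment> \<open>A dense \<open>Y\<close> is non-empty because the phase space is a whole type.
    This step and the next hold for the given \<open>A\<close>; \<open>A = {1..}\<close> enters only
    when the cycle (1), (2), (3), (1) is closed.\<close>
  have 23: "\<exists>x. dense_multi_orbit f m A x" if ?P2
    using that by (metis UNIV_not_empty closure_eq_empty ex_in_conv)
  have 31: "multi_transitive_along f m A"
    if "nds_commutative f" "nds_surjective f" "\<exists>x. dense_multi_orbit f m A x"
    using dense_multi_orbit_imp_multi_transitive[OF assms(1)] assms(2) that by blast
  from 12 23 31 show ?thesis
    by blast
qed

end
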